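(* The simplicial complex $\Delta_{12,33}$ (defined in the context by its $33$ facets on $12$ vertices) is a flag simplicial $3$-sphere.
   Context: Simplicial complexes are finite abstract simplicial complexes; faces are written as strings of vertices (e.g. $x_1x_2y_3=\{x_1,x_2,y_3\}$), and $\langle F_1,\dots,F_k\rangle$ is the complex whose facets (inclusion-maximal faces) are $F_1,\dots,F_k$. The join is $\Delta*\Gamma=\{F\cup G: F\in\Delta, G\in\Gamma\}$, and $\{v\}*\Delta:=\Delta*\langle\{v\}\rangle$ is the cone. A complex $\Delta$ is a simplicial $d$-sphere if its geometric realization is homeomorphic to $\mathbb{S}^d$. A complex is flag if every inclusion-minimal non-face (subset of the vertex set that is not a face) has cardinality $2$; equivalently, it is the clique complex of its graph. For distinct elements $p_1,p_2,p_3,q_1,q_2,q_3$ put $$\Diamond([p_1,p_2,p_3],[q_1,q_2,q_3])=\langle\{p_1\},\{q_1\}\rangle*\langle\{p_2\},\{q_2\}\rangle*\langle\{p_3\},\{q_3\}\rangle,$$ an octahedral $2$-sphere in which $p_i$ and $q_i$ are non-adjacent for each $i$. Definition of $\Delta_{12,33}$: the vertex set is $\{x_1,x_2,x_3,y_1,y_2,y_3,z_1,z_2,z_3,v_1,v_2,v_3\}$ ($12$ distinct elements) and $\Delta_{12,33}=\Gamma_1\cup\Gamma_2$, where $$\Gamma_1=\{v_1\}*\Diamond([x_1,x_2,x_3],[y_1,y_2,y_3])\ \cup\ \{v_2\}*\Diamond([y_1,y_2,y_3],[z_1,z_2,z_3])\ \cup\ \{v_3\}*\Diamond([x_1,x_2,x_3],[z_3,z_1,z_2])$$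 (contributing $24$ facets) and $$\Gamma_2=\langle x_1x_2y_3z_2,\ x_2y_1y_3z_2,\ x_2y_1z_2z_3,\ x_2x_3y_1z_3,\ x_3y_1y_2z_3,\ x_3y_2z_1z_3,\ x_1x_3y_2z_1,\ x_1y_2y_3z_1,\ x_1y_3z_1z_2\rangle$$ (contributing $9$ facets). *)

theory Defs
  imports "HOL-Analysis.Analysis"
begin

text \<open>A complex is given by its set of faces, the empty face included; every vertex is a face,
  so the vertex set is the union of all faces.\<close>

definition abstract_simplicial_complex :: "'a set set \<Rightarrow> bool" where
  "abstract_simplicial_complex K \<longleftrightarrow>
     finite K \<and> (\<forall>F\<in>K. finite F) \<and> {} \<in> K \<and> (\<forall>F\<in>K. \<forall>G\<subseteq>F. G \<in> K)"

text \<open>The complex generated by \<open>Fs\<close>; its facets are exactly the members of \<open>Fs\<close> when these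
  are pairwise incomparable.\<close>

definition generated_complex :: "'a set set \<Rightarrow> 'a set set" where
  "generated_complex Fs = {G. \<exists>F\<in>Fs. G \<subseteq> F}"

definition simplicial_join :: "'a set set \<Rightarrow> 'a set set \<Rightarrow> 'a set set" where
  "simplicial_join K L = {F \<union> G | F G. F \<in> K \<and> G \<in> L}"

definition cone_over :: "'a \<Rightarrow> 'a set set \<Rightarrow> 'a set set" where
  "cone_over v K = simplicial_join (generated_complex {{v}}) K"

definition minimal_nonface :: "'a set set \<Rightarrow> 'a set \<Rightarrow> bool" where
  "minimal_nonface K F \<longleftrightarrow> F \<subseteq> \<Union>K \<and> F \<notin> K \<and> (\<forall>G. G \<subset> F \<longrightarrow> G \<in> K)"

definition flag_complex :: "'a set set \<Rightarrow> bool" where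
  "flag_complex K \<longleftrightarrow> abstract_simplicial_complex K \<and> (\<forall>F. minimal_nonface K F \<longrightarrow> card F = 2)"

text \<open>Points of the realization are systems of barycentric coordinates whose support is a face.
  Only finite complexes are considered, for which the topology of pointwise convergence of the
  coordinates is the usual one.\<close>

definition geometric_realization :: "'a set set \<Rightarrow> ('a \<Rightarrow> real) topology" where
  "geometric_realization K =
     subtopology (powertop_real UNIV)
       {t. (\<forall>v. 0 \<le> t v) \<and> {v. t v \<noteq> 0} \<in> K \<and> (\<Sum>v | t v \<noteq> 0. t v) = 1}"

definition simplicial_sphere :: "nat \<Rightarrow> 'a set set \<Rightarrow> bool" where
  "simplicial_sphere d K \<longleftrightarrow>
     abstract_simplicial_complex K \<and> geometric_realization K homeomorphic_space nsphere d"

fun octahedron :: "'a \<times> 'a \<times> 'a \<Rightarrow> 'a \<times> 'a \<times> 'a \<Rightarrow> 'a set set" where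
  "octahedron (p1, p2, p3) (q1, q2, q3) =
     simplicial_join (simplicial_join (generated_complex {{p1}, {q1}}) (generated_complex {{p2}, {q2}}))
       (generated_complex {{p3}, {q3}})"

datatype vertex = X1 | X2 | X3 | Y1 | Y2 | Y3 | Z1 | Z2 | Z3 | V1 | V2 | V3

definition Gamma1 :: "vertex set set" where
  "Gamma1 =
     cone_over V1 (octahedron (X1, X2, X3) (Y1, Y2, Y3)) \<union>
     cone_over V2 (octahedron (Y1, Y2, Y3) (Z1, Z2, Z3)) \<union>
     cone_over V3 (octahedron (X1, X2, X3) (Z3, Z1, Z2))"

definition Gamma2 :: "vertex set set" where
  "Gamma2 = generated_complex
     {{X1, X2, Y3, Z2}, {X2, Y1, Y3, Z2}, {X2, Y1, Z2, Z3},
      {X2, X3, Y1, Z3}, {X3, Y1, Y2, Z3}, {X3, Y2, Z1, Z3},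
      {X1, X3, Y2, Z1}, {X1, Y2, Y3, Z1}, {X1, Y3, Z1, Z2}}"

definition Delta_12_33 :: "vertex set set" where
  "Delta_12_33 = Gamma1 \<union> Gamma2"

end

theory Submission
  imports Defs
begin

text \<open>The complex arises from the boundary of the 4-simplex on \<open>X1, Y1, Y2, Z1, V2\<close> by seven stellar
  subdivisions, and a stellar subdivision does not change the homeomorphism type of the geometric
  realization. Flagness is a finite check: every face has to extend by every vertex adjacent to all
  of its vertices.\<close>

section \<open>Points of the geometric realization\<close>

definition realization_points :: "'a set set \<Rightarrow> ('a \<Rightarrow> real) set" where
  "realization_points K =
     {t. (\<forall>v. 0 \<le> t v) \<and> {v. t v \<noteq> 0} \<in> K \<and> (\<Sum>v | t v \<noteq> 0. t v) = 1}"

text \<open>\<open>powertop_real UNIV\<close> is the type-class topology on real-valued functions,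
  so continuity can be handled coordinatewise with \<open>continuous_on\<close>.\<close>

lemma geometric_realization_eq:
  "geometric_realization K = top_of_set (realization_points K)"
  by (simp add: geometric_realization_def realization_points_def euclidean_product_topology)

lemma nsphere_eq:
  "nsphere n = top_of_set {x. (\<Sum>i\<le>n. (x i)\<^sup>2) = 1 \<and> (\<forall>i>n. x i = 0)}"
  by (simp add: nsphere euclidean_product_topology)

lemma homeomorphic_space_top_of_setI:
  fixes S :: "'a::topological_space set" and T :: "'b::topological_space set"
  assumes "continuous_on S f" "continuous_on T g"
    and "\<And>x. x \<in> S \<Longrightarrow> f x \<in> T" "\<And>y. y \<in> T \<Longrightarrow> g y \<in> S"
    and "\<And>x. x \<in> S \<Longrightarrow> g (f x) = x" "\<And>y. y \<in> T \<Longrightarrow> f (g y) = y"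
  shows "top_of_set S homeomorphic_space top_of_set T"
  unfolding homeomorphic_space_def homeomorphic_maps_def
  using assms by (intro exI[of _ f] exI[of _ g]) auto

lemma continuous_on_coordinate: "continuous_on S (\<lambda>x. x a :: real)"
  by (auto intro: continuous_on_subset[OF continuous_on_product_coordinates])

lemma continuous_on_Min_coordinates:
  fixes S :: "('a \<Rightarrow> real) set"
  assumes "finite A" "A \<noteq> {}"
  shows "continuous_on S (\<lambda>x. Min (x ` A))"
  using assms
proof (induction A rule: finite_ne_induct)
  case (singleton a)
  then show ?case
    by (simp add: continuous_on_coordinate)
next
  case (insert a A)
  have "continuous_on S (\<lambda>x. min (x a) (Min (x ` A)))"
    using insert by (intro continuous_on_min continuous_on_coordinate)
  with insert show ?case
    by simp
qed

text \<open>Coordinates outside the support contribute nothing, so the sum may run over a fixed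
  finite set \<open>U\<close> instead of a support that varies with the point.\<close>

lemma realization_pointsI:
  assumes "\<And>v. 0 \<le> t v" "{v. t v \<noteq> 0} \<in> K" "finite U" "{v. t v \<noteq> 0} \<subseteq> U" "sum t U = 1"
  shows "t \<in> realization_points K"
proof -
  have "sum t {v. t v \<noteq> 0} = sum t U"
    using assms by (intro sum.mono_neutral_left) auto
  with assms show ?thesis
    by (simp add: realization_points_def)
qed

lemma realization_points_nonneg: "t \<in> realization_points K \<Longrightarrow> 0 \<le> t v"
  by (simp add: realization_points_def)

lemma realization_points_support: "t \<in> realization_points K \<Longrightarrow> {v. t v \<noteq> 0} \<in> K"
  by (simp add: realization_points_def)

lemma realization_points_sum:
  assumes "t \<in> realization_points K" "finite U" "{v. t v \<noteq> 0} \<subseteq> U"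
  shows "sum t U = 1"
proof -
  have "sum t {v. t v \<noteq> 0} = sum t U"
    using assms by (intro sum.mono_neutral_left) auto
  with assms show ?thesis
    by (simp add: realization_points_def)
qed

section \<open>Stellar subdivision\<close>

text \<open>For a face \<open>A\<close>, the second part consists of the faces through
  \<open>w\<close> of the cone over the join of the boundary of \<open>A\<close> with its link;
  \<open>F\<close> may meet \<open>A\<close>, which leaves the join implicit.\<close>

definition stellar_subdivision :: "'a set set \<Rightarrow> 'a set \<Rightarrow> 'a \<Rightarrow> 'a set set" where
  "stellar_subdivision K A w =
     {F \<in> K. \<not> A \<subseteq> F} \<union> {insert w F | F. F \<union> A \<in> K \<and> \<not> A \<subseteq> F}"

definition stellar_map :: "'a set \<Rightarrow> 'a \<Rightarrow> ('a \<Rightarrow> real) \<Rightarrow> 'a \<Rightarrow> real" where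
  "stellar_map A w t v =
     (if v = w then 0 else if v \<in> A then t v + t w / real (card A) else t v)"

definition stellar_inverse :: "'a set \<Rightarrow> 'a \<Rightarrow> ('a \<Rightarrow> real) \<Rightarrow> 'a \<Rightarrow> real" where
  "stellar_inverse A w s v =
     (if v = w then real (card A) * Min (s ` A) else if v \<in> A then s v - Min (s ` A) else s v)"

context
  fixes K :: "'a set set" and A :: "'a set" and w :: 'a and U :: "'a set"
  assumes K: "abstract_simplicial_complex K"
    and A: "finite A" "A \<noteq> {}"
    and w: "w \<notin> A" "w \<notin> \<Union>K"
  defines "U \<equiv> insert w (A \<union> \<Union>K)"
begin

lemma finite_U: "finite U"
  using K A by (auto simp: U_def abstract_simplicial_complex_def)

text \<open>The three summands match the three cases in \<open>stellar_map\<close> and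
  \<open>stellar_inverse\<close>; \<open>U\<close> contains the supports of the points on both
  sides.\<close>

lemma sum_U:
  fixes f :: "'a \<Rightarrow> real"
  shows "sum f U = f w + sum f A + sum f (\<Union>K - A)"
proof -
  have "U = insert w (A \<union> (\<Union>K - A))"
    by (auto simp: U_def)
  moreover have "finite (\<Union>K - A)"
    using finite_U by (auto simp: U_def)
  moreover have "w \<notin> A \<union> (\<Union>K - A)" "A \<inter> (\<Union>K - A) = {}"
    using w by auto
  ultimately show ?thesis
    using A by (metis (no_types, lifting) add.assoc finite_UnI sum.insert sum.union_disjoint)
qed

lemma face_mono: "F \<in> K \<Longrightarrow> G \<subseteq> F \<Longrightarrow> G \<in> K"
  using K by (auto simp: abstract_simplicial_complex_def)

lemma stellar_support_subset:
  assumes "t \<in> realization_points (stellar_subdivision K A w)"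
  shows "{v. t v \<noteq> 0} \<subseteq> U"
proof -
  have "{v. t v \<noteq> 0} \<in> stellar_subdivision K A w"
    using assms by (rule realization_points_support)
  then show ?thesis
    unfolding stellar_subdivision_def U_def by blast
qed

lemma not_subset_stellar_support:
  assumes "t \<in> realization_points (stellar_subdivision K A w)"
  shows "\<exists>a\<in>A. t a = 0"
proof -
  have "{v. t v \<noteq> 0} \<in> stellar_subdivision K A w"
    using assms by (rule realization_points_support)
  then have "\<not> A \<subseteq> {v. t v \<noteq> 0}"
    using w(1) by (auto simp: stellar_subdivision_def)
  then show ?thesis
    by blast
qed

text \<open>The weight at \<open>w\<close> is spread over \<open>A\<close> in \<open>card A\<close>
  equal shares, which keeps the total. If it is positive, the new support lies in some
  \<open>F \<union> A\<close>, which is a face of \<open>K\<close>.\<close>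

lemma stellar_map_in:
  assumes t: "t \<in> realization_points (stellar_subdivision K A w)"
  shows "stellar_map A w t \<in> realization_points K"
proof (rule realization_pointsI[OF _ _ finite_U])
  note nn = realization_points_nonneg[OF t]
  have supp: "{v. t v \<noteq> 0} \<in> stellar_subdivision K A w"
    using t by (rule realization_points_support)
  show "0 \<le> stellar_map A w t v" for v
    using nn by (simp add: stellar_map_def)
  show "{v. stellar_map A w t v \<noteq> 0} \<in> K"
  proof (cases "t w = 0")
    case True
    then have "{v. stellar_map A w t v \<noteq> 0} = {v. t v \<noteq> 0}"
      by (auto simp: stellar_map_def)
    moreover have "{v. t v \<noteq> 0} \<in> K"
      using supp True by (auto simp: stellar_subdivision_def)
    ultimately show ?thesis
      by simp
  next
    case False
    with supp w(2) obtain F where F: "{v. t v \<noteq> 0} = insert w F" "F \<union> A \<in> K"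
      by (auto simp: stellar_subdivision_def)
    have "{v. stellar_map A w t v \<noteq> 0} \<subseteq> F \<union> A"
      using F(1) by (auto simp: stellar_map_def)
    with F(2) show ?thesis
      by (rule face_mono)
  qed
  then show "{v. stellar_map A w t v \<noteq> 0} \<subseteq> U"
    by (auto simp: U_def)
  have "sum (stellar_map A w t) U
        = (\<Sum>v\<in>A. t v + t w / real (card A)) + sum t (\<Union>K - A)"
    unfolding sum_U using w
    by (intro arg_cong2[where f = "(+)"]) (auto simp: stellar_map_def intro!: sum.cong)
  also have "\<dots> = sum t U"
    unfolding sum_U using A by (simp add: sum.distrib)
  also have "\<dots> = 1"
    by (rule realization_points_sum[OF t finite_U stellar_support_subset[OF t]])
  finally show "sum (stellar_map A w t) U = 1" .
qed

lemma stellar_inverse_in: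
  assumes s: "s \<in> realization_points K"
  shows "stellar_inverse A w s \<in> realization_points (stellar_subdivision K A w)"
proof (rule realization_pointsI[OF _ _ finite_U])
  note nn = realization_points_nonneg[OF s]
  have supp: "{v. s v \<noteq> 0} \<in> K"
    using s by (rule realization_points_support)
  define m where "m = Min (s ` A)"
  have inv: "stellar_inverse A w s v =
      (if v = w then real (card A) * m else if v \<in> A then s v - m else s v)" for v
    by (simp add: stellar_inverse_def m_def)
  have m_le: "m \<le> s a" if "a \<in> A" for a
    using A that by (simp add: m_def)
  have "m \<in> s ` A"
    unfolding m_def using A by (intro Min_in) auto
  then obtain a where a: "a \<in> A" "s a = m"
    by auto
  have m_nn: "0 \<le> m"
    using nn[of a] a by simp
  show "0 \<le> stellar_inverse A w s v" for v
    using nn m_nn m_le by (simp add: inv)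
  have sw: "s w = 0"
    using supp w(2) by blast
  show "{v. stellar_inverse A w s v \<noteq> 0} \<in> stellar_subdivision K A w"
  proof (cases "m = 0")
    case True
    then have "{v. stellar_inverse A w s v \<noteq> 0} = {v. s v \<noteq> 0}"
      using sw by (auto simp: inv)
    then show ?thesis
      using supp a True by (auto simp: stellar_subdivision_def)
  next
    case False
    then have sub: "A \<subseteq> {v. s v \<noteq> 0}"
      using m_le m_nn by fastforce
    \<comment> \<open>Subtracting the minimum kills exactly the vertices of \<open>A\<close> where
      it is attained; at least one exists, so \<open>F\<close> no longer contains
      \<open>A\<close>.\<close>
    define F where "F = {v. s v \<noteq> 0} - {v \<in> A. s v = m}"
    have "{v. stellar_inverse A w s v \<noteq> 0} = insert w F"
      using A False sw sub w(1) by (auto simp: inv F_def)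
    moreover have "F \<union> A = {v. s v \<noteq> 0}"
      using sub by (auto simp: F_def)
    moreover have "\<not> A \<subseteq> F"
      using a by (auto simp: F_def)
    ultimately show ?thesis
      using supp by (auto simp: stellar_subdivision_def)
  qed
  then show "{v. stellar_inverse A w s v \<noteq> 0} \<subseteq> U"
    unfolding stellar_subdivision_def U_def by blast
  have "sum (stellar_inverse A w s) U
        = real (card A) * m + (\<Sum>v\<in>A. s v - m) + sum s (\<Union>K - A)"
    unfolding sum_U using w
    by (intro arg_cong2[where f = "(+)"]) (auto simp: inv intro!: sum.cong)
  also have "\<dots> = sum s U"
    unfolding sum_U using A sw by (simp add: sum_subtractf)
  also have "\<dots> = 1"
    using supp by (intro realization_points_sum[OF s finite_U]) (auto simp: U_def)
  finally show "sum (stellar_inverse A w s) U = 1" .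
qed

text \<open>Some coordinate on \<open>A\<close> vanishes, so after the equal shares are added the
  minimum over \<open>A\<close> is exactly one share, and subtracting it undoes the map.\<close>

lemma stellar_inverse_map:
  assumes t: "t \<in> realization_points (stellar_subdivision K A w)"
  shows "stellar_inverse A w (stellar_map A w t) = t"
proof -
  obtain a where a: "a \<in> A" "t a = 0"
    using not_subset_stellar_support[OF t] by blast
  have "Min (stellar_map A w t ` A) = t w / real (card A)"
  proof (rule Min_eqI)
    show "finite (stellar_map A w t ` A)"
      using A by simp
    show "t w / real (card A) \<in> stellar_map A w t ` A"
      using a w(1) by (intro image_eqI[of _ _ a]) (auto simp: stellar_map_def)
    show "t w / real (card A) \<le> y" if "y \<in> stellar_map A w t ` A" for y
      using that w(1) realization_points_nonneg[OF t] by (auto simp: stellar_map_def)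
  qed
  then show ?thesis
    using A by (intro ext) (simp add: stellar_inverse_def stellar_map_def)
qed

lemma stellar_map_inverse:
  assumes s: "s \<in> realization_points K"
  shows "stellar_map A w (stellar_inverse A w s) = s"
proof -
  have "s w = 0"
    using realization_points_support[OF s] w(2) by blast
  then show ?thesis
    using A by (intro ext) (simp add: stellar_inverse_def stellar_map_def)
qed

text \<open>The new vertex is placed at the barycenter of \<open>A\<close>; in the other direction, its coordinate is
  the largest multiple of the barycenter that can be split off.\<close>

lemma stellar_subdivision_homeomorphic:
  "geometric_realization (stellar_subdivision K A w) homeomorphic_space geometric_realization K"
  unfolding geometric_realization_eq
proof (rule homeomorphic_space_top_of_setI)
  have "continuous_on S (\<lambda>t. stellar_map A w t v)" for S v
    unfolding stellar_map_def
    by (cases "v = w"; cases "v \<in> A") (auto intro!: continuous_intros continuous_on_coordinate simp: A)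
  then show "continuous_on (realization_points (stellar_subdivision K A w)) (stellar_map A w)"
    by (rule continuous_on_coordinatewise_then_product)
  have "continuous_on S (\<lambda>s. stellar_inverse A w s v)" for S v
    unfolding stellar_inverse_def
    by (cases "v = w"; cases "v \<in> A")
      (auto intro!: continuous_intros continuous_on_coordinate continuous_on_Min_coordinates simp: A)
  then show "continuous_on (realization_points K) (stellar_inverse A w)"
    by (rule continuous_on_coordinatewise_then_product)
qed (fact stellar_map_in stellar_inverse_in stellar_inverse_map stellar_map_inverse)+

end

section \<open>The boundary of a simplex\<close>

definition simplex_boundary :: "'a set \<Rightarrow> 'a set set" where
  "simplex_boundary T = {F. F \<subset> T}"

text \<open>The boundary of the simplex is carried to the unit sphere by forgetting the line spanned by
  the all-ones vector (the last coordinate is normalized to \<open>0\<close>) and projecting radially. A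
  vector comes back by subtracting its smallest coordinate.\<close>

lemma simplex_boundary_homeomorphic_nsphere:
  assumes T: "finite T" "card T = n + 2"
  shows "geometric_realization (simplex_boundary T) homeomorphic_space nsphere n"
proof -
  let ?R = "realization_points (simplex_boundary T)"
  let ?S = "{x :: nat \<Rightarrow> real. (\<Sum>i\<le>n. (x i)\<^sup>2) = 1 \<and> (\<forall>i>n. x i = 0)}"
  \<comment> \<open>The \<open>n + 2\<close> vertices are numbered \<open>0\<close> to
    \<open>Suc n\<close>; index \<open>Suc n\<close> is the last coordinate, which is 0 on the
    sphere.\<close>
  obtain h where h: "bij_betw h {..Suc n} T"
    using T by (metis add_2_eq_Suc' card_atMost finite_atMost finite_same_card_bij)
  define k where "k = the_inv_into {..Suc n} h"
  have kh: "k (h i) = i" if "i \<le> Suc n" for i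
    using h that by (simp add: k_def bij_betw_def the_inv_into_f_f)
  have hk: "h (k v) = v" and k_le: "k v \<le> Suc n" if "v \<in> T" for v
    using h that the_inv_into_into[of h "{..Suc n}" v "{..Suc n}"]
    by (auto simp: k_def bij_betw_def f_the_inv_into_f)
  have hT: "h i \<in> T" if "i \<le> Suc n" for i
    using h that by (auto simp: bij_betw_def)
  have sum_T: "sum f T = (\<Sum>i\<le>Suc n. f (h i))" for f :: "'a \<Rightarrow> real"
    using sum.reindex_bij_betw[OF h, of f] by simp

  \<comment> \<open>\<open>d\<close> is the representative modulo the all-ones vector whose last
    coordinate is 0, and \<open>f\<close> scales it to norm 1; \<open>e\<close> is the one whose
    smallest coordinate is 0, and \<open>g\<close> scales it to sum 1.\<close>
  define d where "d t i = (if i \<le> n then t (h i) - t (h (Suc n)) else 0)" for t :: "'a \<Rightarrow> real" and i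
  define N where "N t = sqrt (\<Sum>i\<le>n. (d t i)\<^sup>2)" for t :: "'a \<Rightarrow> real"
  define f where "f t i = d t i / N t" for t :: "'a \<Rightarrow> real" and i
  define m where "m x = Min (x ` {..Suc n})" for x :: "nat \<Rightarrow> real"
  define e where "e x v = (if v \<in> T then x (k v) - m x else 0)" for x :: "nat \<Rightarrow> real" and v
  define M where "M x = sum (e x) T" for x :: "nat \<Rightarrow> real"
  define g where "g x v = e x v / M x" for x :: "nat \<Rightarrow> real" and v

  have R_nn: "0 \<le> t v" if "t \<in> ?R" for t v
    using that by (rule realization_points_nonneg)
  have R_out: "t v = 0" if "t \<in> ?R" "v \<notin> T" for t v
    using realization_points_support[OF that(1)] that(2) by (auto simp: simplex_boundary_def)
  have R_zero: "\<exists>i\<le>Suc n. t (h i) = 0" if "t \<in> ?R" for t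
    using realization_points_support[OF that] hk k_le by (fastforce simp: simplex_boundary_def)
  have R_sum: "sum t T = 1" if "t \<in> ?R" for t
    using realization_points_sum[OF that T(1)] realization_points_support[OF that]
    by (auto simp: simplex_boundary_def)

  \<comment> \<open>If \<open>N t\<close> vanished, all coordinates would be equal, hence 0 because
    one of them is, against the sum 1.\<close>
  have N_pos: "N t > 0" if t: "t \<in> ?R" for t
  proof (rule ccontr)
    assume "\<not> N t > 0"
    then have "(\<Sum>i\<le>n. (d t i)\<^sup>2) = 0"
      by (simp add: N_def sum_nonneg order_antisym not_less)
    then have "d t i = 0" if "i \<le> n" for i
      using that by (simp add: sum_nonneg_eq_0_iff)
    then have eq: "t (h i) = t (h (Suc n))" if "i \<le> Suc n" for i
      using that by (cases "i = Suc n") (auto simp: d_def)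
    obtain j where "j \<le> Suc n" "t (h j) = 0"
      using R_zero[OF t] by blast
    with eq have "t (h i) = 0" if "i \<le> Suc n" for i
      using that by metis
    then have "sum t T = 0"
      by (simp add: sum_T)
    with R_sum[OF t] show False
      by simp
  qed

  have S_last: "x (Suc n) = 0" if "x \<in> ?S" for x
    using that by simp
  have m_le: "m x \<le> x i" if "i \<le> Suc n" for x i
    using that by (simp add: m_def)
  have m_attained: "\<exists>i\<le>Suc n. x i = m x" for x
  proof -
    have "m x \<in> x ` {..Suc n}"
      unfolding m_def by (intro Min_in) auto
    then show ?thesis
      by auto
  qed
  have e_nn: "0 \<le> e x v" for x v
    using m_le k_le by (simp add: e_def)
  \<comment> \<open>If \<open>M x\<close> vanished, \<open>x\<close> would be constant up to index
    \<open>Suc n\<close>, hence 0 like its last coordinate, against the norm 1.\<close>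
  have M_pos: "M x > 0" if x: "x \<in> ?S" for x
  proof (rule ccontr)
    assume "\<not> M x > 0"
    then have "sum (e x) T = 0"
      using e_nn by (simp add: M_def sum_nonneg order_antisym not_less)
    then have "e x v = 0" if "v \<in> T" for v
      using that e_nn T by (simp add: sum_nonneg_eq_0_iff)
    then have "x i = m x" if "i \<le> Suc n" for i
      using that hT[of i] kh[of i] by (force simp: e_def)
    then have "x i = 0" if "i \<le> n" for i
      using that S_last[OF x] by (metis le_SucI order_refl)
    then have "(\<Sum>i\<le>n. (x i)\<^sup>2) = 0"
      by simp
    with x show False
      by simp
  qed

  have f_in: "f t \<in> ?S" if t: "t \<in> ?R" for t
  proof -
    have "(\<Sum>i\<le>n. (f t i)\<^sup>2) = (\<Sum>i\<le>n. (d t i)\<^sup>2) / (N t)\<^sup>2"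
      by (simp add: f_def power_divide sum_divide_distrib)
    also have "(N t)\<^sup>2 = (\<Sum>i\<le>n. (d t i)\<^sup>2)"
      by (simp add: N_def sum_nonneg)
    finally show ?thesis
      using N_pos[OF t] by (simp add: f_def d_def N_def)
  qed
  have g_in: "g x \<in> ?R" if x: "x \<in> ?S" for x
  proof (rule realization_pointsI[OF _ _ T(1)])
    show "0 \<le> g x v" for v
      using e_nn M_pos[OF x] by (simp add: g_def)
    show sub: "{v. g x v \<noteq> 0} \<subseteq> T"
      by (auto simp: g_def e_def)
    obtain i where i: "i \<le> Suc n" "x i = m x"
      using m_attained by blast
    then have "g x (h i) = 0"
      by (simp add: g_def e_def kh)
    with sub hT[OF i(1)] show "{v. g x v \<noteq> 0} \<in> simplex_boundary T"
      by (auto simp: simplex_boundary_def)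
    show "sum (g x) T = 1"
      using M_pos[OF x] by (simp add: g_def M_def flip: sum_divide_distrib)
  qed

  have gf: "g (f t) = t" if t: "t \<in> ?R" for t
  proof -
    have ft: "f t i = (t (h i) - t (h (Suc n))) / N t" if "i \<le> Suc n" for i
      using that by (cases "i = Suc n") (auto simp: f_def d_def)
    obtain j where j: "j \<le> Suc n" "t (h j) = 0"
      using R_zero[OF t] by blast
    \<comment> \<open>The minimum is attained where \<open>t\<close> vanishes, since the coordinates
      of \<open>t\<close> are nonnegative; subtracting it cancels the shift by
      \<open>t (h (Suc n))\<close>.\<close>
    have "m (f t) = - t (h (Suc n)) / N t"
      unfolding m_def
    proof (rule Min_eqI)
      show "- t (h (Suc n)) / N t \<in> f t ` {..Suc n}"
        using j ft by (intro image_eqI[of _ _ j]) auto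
      show "- t (h (Suc n)) / N t \<le> y" if "y \<in> f t ` {..Suc n}" for y
        using that ft R_nn[OF t] N_pos[OF t] by (auto simp: divide_le_cancel diff_divide_distrib)
    qed simp
    then have e: "e (f t) v = t v / N t" for v
      by (cases "v \<in> T") (simp_all add: e_def ft k_le hk R_out[OF t] diff_divide_distrib)
    then have "M (f t) = 1 / N t"
      using R_sum[OF t] by (simp add: M_def flip: sum_divide_distrib)
    then show ?thesis
      using N_pos[OF t] by (intro ext) (simp add: g_def e)
  qed
  have fg: "f (g x) = x" if x: "x \<in> ?S" for x
  proof -
    \<comment> \<open>The shift \<open>m x\<close> cancels in the difference and
      \<open>x (Suc n) = 0\<close>; beyond \<open>n\<close> both sides are 0.\<close>
    have d: "d (g x) i = x i / M x" for i
      using x S_last[OF x] by (auto simp: d_def g_def e_def hT kh diff_divide_distrib)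
    have "(\<Sum>i\<le>n. (d (g x) i)\<^sup>2) = (1 / M x)\<^sup>2"
      using x by (simp add: d power_divide flip: sum_divide_distrib)
    then have "N (g x) = 1 / M x"
      using M_pos[OF x] by (simp add: N_def real_sqrt_divide)
    then show ?thesis
      using M_pos[OF x] by (intro ext) (simp add: f_def d)
  qed

  have cont_d: "continuous_on ?R (\<lambda>t. d t i)" for i
    unfolding d_def by (cases "i \<le> n") (auto intro!: continuous_intros continuous_on_coordinate)
  have "continuous_on ?R (\<lambda>t. f t i)" for i
    unfolding f_def N_def
    using N_pos by (intro continuous_intros cont_d) (force simp: N_def)
  then have cont_f: "continuous_on ?R f"
    by (rule continuous_on_coordinatewise_then_product)
  have cont_e: "continuous_on ?S (\<lambda>x. e x v)" for v
    unfolding e_def m_def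
    by (cases "v \<in> T")
      (auto intro!: continuous_intros continuous_on_coordinate continuous_on_Min_coordinates)
  have "continuous_on ?S (\<lambda>x. g x v)" for v
    unfolding g_def M_def
    using M_pos by (intro continuous_intros cont_e) (force simp: M_def)
  then have cont_g: "continuous_on ?S g"
    by (rule continuous_on_coordinatewise_then_product)
  show ?thesis
    unfolding geometric_realization_eq nsphere_eq
    by (rule homeomorphic_space_top_of_setI) (fact cont_f cont_g f_in g_in gf fg)+
qed

section \<open>Complexes given by their facets\<close>

lemma abstract_simplicial_complex_generated:
  assumes "finite Fs" "Fs \<noteq> {}" "\<forall>F\<in>Fs. finite F"
  shows "abstract_simplicial_complex (generated_complex Fs)"
proof -
  have "generated_complex Fs = (\<Union>F\<in>Fs. Pow F)"
    by (auto simp: generated_complex_def)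
  then have "finite (generated_complex Fs)"
    using assms by simp
  with assms show ?thesis
    unfolding abstract_simplicial_complex_def generated_complex_def
    by (auto intro: finite_subset)
qed

text \<open>Counterpart of \<open>stellar_subdivision\<close> on generating sets, so that a chain of
  subdivisions can be evaluated. A facet through \<open>A\<close> splits into one piece opposite
  each vertex of \<open>A\<close>.\<close>

definition stellar_facets :: "'a set set \<Rightarrow> 'a set \<Rightarrow> 'a \<Rightarrow> 'a set set" where
  "stellar_facets Fs A w =
     {F \<in> Fs. \<not> A \<subseteq> F} \<union> (\<Union>F\<in>{F \<in> Fs. A \<subseteq> F}. (\<lambda>a. insert w (F - {a})) ` A)"

text \<open>A face not containing \<open>A\<close> misses some \<open>a \<in> A\<close>, so inside a
  facet \<open>F\<close> it lies in \<open>F - {a}\<close>. Freshness of \<open>w\<close> separates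
  the new faces from the old ones.\<close>

lemma generated_complex_stellar_facets:
  assumes w: "w \<notin> \<Union>Fs"
  shows "generated_complex (stellar_facets Fs A w) = stellar_subdivision (generated_complex Fs) A w"
proof (intro equalityI subsetI)
  fix G
  assume "G \<in> generated_complex (stellar_facets Fs A w)"
  then consider (old) F where "F \<in> Fs" "\<not> A \<subseteq> F" "G \<subseteq> F"
    | (new) F a where "F \<in> Fs" "A \<subseteq> F" "a \<in> A" "G \<subseteq> insert w (F - {a})"
    by (auto simp: generated_complex_def stellar_facets_def)
  then show "G \<in> stellar_subdivision (generated_complex Fs) A w"
  proof cases
    case old
    then show ?thesis
      by (auto simp: generated_complex_def stellar_subdivision_def)
  next
    case new
    show ?thesis
    proof (cases "w \<in> G")
      case True
      then have "G = insert w (G - {w})" "G - {w} \<union> A \<subseteq> F" "\<not> A \<subseteq> G - {w}"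
        using new w by auto
      with \<open>F \<in> Fs\<close> show ?thesis
        unfolding generated_complex_def stellar_subdivision_def by blast
    next
      case False
      then have "G \<subseteq> F" "\<not> A \<subseteq> G"
        using new w by auto
      with \<open>F \<in> Fs\<close> show ?thesis
        unfolding generated_complex_def stellar_subdivision_def by blast
    qed
  qed
next
  fix G
  assume "G \<in> stellar_subdivision (generated_complex Fs) A w"
  then have "(\<exists>F\<in>Fs. G \<subseteq> F \<and> \<not> A \<subseteq> G) \<or>
      (\<exists>H. \<exists>F\<in>Fs. H \<union> A \<subseteq> F \<and> \<not> A \<subseteq> H \<and> G = insert w H)"
    unfolding stellar_subdivision_def generated_complex_def Un_iff mem_Collect_eq by metis
  then consider (old) F where "F \<in> Fs" "G \<subseteq> F" "\<not> A \<subseteq> G"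
    | (new) F H where "F \<in> Fs" "H \<union> A \<subseteq> F" "\<not> A \<subseteq> H" "G = insert w H"
    by blast
  then show "G \<in> generated_complex (stellar_facets Fs A w)"
  proof cases
    case old
    then obtain a where "a \<in> A" "a \<notin> G"
      by blast
    have "F \<in> stellar_facets Fs A w \<or> insert w (F - {a}) \<in> stellar_facets Fs A w"
      using old(1) \<open>a \<in> A\<close> by (auto simp: stellar_facets_def)
    moreover have "G \<subseteq> insert w (F - {a})"
      using old(2) \<open>a \<notin> G\<close> by auto
    ultimately show ?thesis
      using old(2) by (auto simp: generated_complex_def)
  next
    case new
    then obtain a where "a \<in> A" "a \<notin> H"
      by blast
    with new have "G \<subseteq> insert w (F - {a})" "insert w (F - {a}) \<in> stellar_facets Fs A w"
      by (auto simp: stellar_facets_def)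
    then show ?thesis
      by (auto simp: generated_complex_def)
  qed
qed

lemma simplicial_sphere_stellar_facets:
  assumes sphere: "simplicial_sphere d (generated_complex Fs)"
    and fin: "finite Fs" "\<forall>F\<in>Fs. finite F" "finite A" "A \<noteq> {}"
    and w: "w \<notin> A" "w \<notin> \<Union>Fs"
  shows "simplicial_sphere d (generated_complex (stellar_facets Fs A w))"
proof -
  have K: "abstract_simplicial_complex (generated_complex Fs)"
    using sphere by (simp add: simplicial_sphere_def)
  have "w \<notin> \<Union>(generated_complex Fs)"
    using w(2) by (auto simp: generated_complex_def)
  from stellar_subdivision_homeomorphic[OF K fin(3,4) w(1) this]
  have "geometric_realization (generated_complex (stellar_facets Fs A w))
          homeomorphic_space nsphere d"
    unfolding generated_complex_stellar_facets[OF w(2)]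
    using sphere by (auto simp: simplicial_sphere_def intro: homeomorphic_space_trans)
  moreover have "Fs \<noteq> {}"
    using K by (auto simp: abstract_simplicial_complex_def generated_complex_def)
  then obtain F where F: "F \<in> Fs"
    by blast
  have "stellar_facets Fs A w \<noteq> {}"
    using F fin(4) by (cases "A \<subseteq> F") (auto simp: stellar_facets_def)
  then have "abstract_simplicial_complex (generated_complex (stellar_facets Fs A w))"
    using fin by (intro abstract_simplicial_complex_generated) (auto simp: stellar_facets_def)
  ultimately show ?thesis
    by (simp add: simplicial_sphere_def)
qed

text \<open>Base of the chain of subdivisions: every proper subset of \<open>T\<close> avoids some
  \<open>v \<in> T\<close>, so these generators give the boundary of the simplex.\<close>

lemma simplicial_sphere_simplex_boundary:
  assumes "finite T" "card T = n + 2"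
  shows "simplicial_sphere n (generated_complex ((\<lambda>v. T - {v}) ` T))"
proof -
  have "generated_complex ((\<lambda>v. T - {v}) ` T) = simplex_boundary T"
    by (auto simp: generated_complex_def simplex_boundary_def)
  moreover have "abstract_simplicial_complex (generated_complex ((\<lambda>v. T - {v}) ` T))"
    using assms by (intro abstract_simplicial_complex_generated) auto
  ultimately show ?thesis
    using simplex_boundary_homeomorphic_nsphere[OF assms] by (simp add: simplicial_sphere_def)
qed

text \<open>Adding the vertices of a clique one at a time, it suffices that every facet can be extended by
  every vertex after discarding the non-neighbours of that vertex.\<close>

lemma flag_complex_generatedI:
  assumes fin: "finite Fs" "Fs \<noteq> {}" "\<forall>F\<in>Fs. finite F"
    and ext: "\<And>F v. F \<in> Fs \<Longrightarrow> v \<in> \<Union>Fs \<Longrightarrow>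
      insert v {u \<in> F. \<exists>G\<in>Fs. u \<in> G \<and> v \<in> G} \<in> generated_complex Fs"
  shows "flag_complex (generated_complex Fs)"
proof -
  let ?K = "generated_complex Fs"
  have K: "abstract_simplicial_complex ?K"
    using fin by (rule abstract_simplicial_complex_generated)
  have vertices: "\<Union>?K = \<Union>Fs"
    by (auto simp: generated_complex_def)
  have clique: "F \<in> ?K" if "finite F" "F \<subseteq> \<Union>Fs" "\<forall>u\<in>F. \<forall>v\<in>F. {u, v} \<in> ?K" for F
    using that
  proof (induction F rule: finite_induct)
    case empty
    then show ?case
      using fin by (auto simp: generated_complex_def)
  next
    case (insert v F)
    then obtain H where H: "H \<in> Fs" "F \<subseteq> H"
      by (auto simp: generated_complex_def)
    have "insert v {u \<in> H. \<exists>G\<in>Fs. u \<in> G \<and> v \<in> G} \<in> ?K"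
      using H insert.prems by (intro ext) auto
    \<comment> \<open>All vertices of \<open>F\<close> are adjacent to \<open>v\<close>, so
      discarding the non-neighbours of \<open>v\<close> from \<open>H\<close> leaves
      \<open>F\<close> intact.\<close>
    moreover have "insert v F \<subseteq> insert v {u \<in> H. \<exists>G\<in>Fs. u \<in> G \<and> v \<in> G}"
      using H insert.prems by (auto simp: generated_complex_def)
    ultimately show ?case
      using K by (auto simp: abstract_simplicial_complex_def)
  qed
  have "card F = 2" if F: "minimal_nonface ?K F" for F
  proof (rule ccontr)
    assume card: "card F \<noteq> 2"
    have sub: "F \<subseteq> \<Union>Fs" and nonface: "F \<notin> ?K" and faces: "\<And>G. G \<subset> F \<Longrightarrow> G \<in> ?K"
      using F vertices by (auto simp: minimal_nonface_def)
    have "finite F"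
      using sub fin by (meson finite_Union finite_subset)
    \<comment> \<open>Singletons are faces, and a two-element subset of \<open>F\<close> is proper
      because \<open>card F \<noteq> 2\<close>; so \<open>F\<close> would be a clique and thus a
      face.\<close>
    have "{u, v} \<in> ?K" if uv: "u \<in> F" "v \<in> F" for u v
    proof (cases "u = v")
      case True
      with uv sub show ?thesis
        by (auto simp: generated_complex_def)
    next
      case False
      with card have "{u, v} \<noteq> F"
        by auto
      with uv show ?thesis
        by (intro faces) auto
    qed
    with \<open>finite F\<close> sub nonface clique show False
      by blast
  qed
  with K show ?thesis
    by (simp add: flag_complex_def)
qed

text \<open>Expresses joins, and hence cones and octahedra, through finite generating sets that can
  be evaluated.\<close>

lemma simplicial_join_generated:
  "simplicial_join (generated_complex Fs) (generated_complex Gs)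
     = generated_complex (\<Union>F\<in>Fs. (\<lambda>G. F \<union> G) ` Gs)"
proof (intro equalityI subsetI)
  fix H
  assume "H \<in> simplicial_join (generated_complex Fs) (generated_complex Gs)"
  then obtain F' G' F G where "F \<in> Fs" "F' \<subseteq> F" "G \<in> Gs" "G' \<subseteq> G" and H: "H = F' \<union> G'"
    by (auto simp: simplicial_join_def generated_complex_def)
  then have "H \<subseteq> F \<union> G"
    by auto
  with \<open>F \<in> Fs\<close> \<open>G \<in> Gs\<close> show "H \<in> generated_complex (\<Union>F\<in>Fs. (\<lambda>G. F \<union> G) ` Gs)"
    by (auto simp: generated_complex_def)
next
  fix H
  assume "H \<in> generated_complex (\<Union>F\<in>Fs. (\<lambda>G. F \<union> G) ` Gs)"
  then obtain F G where "F \<in> Fs" "G \<in> Gs" "H \<subseteq> F \<union> G"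
    by (auto simp: generated_complex_def)
  then have "H = (H \<inter> F) \<union> (H \<inter> G)" "H \<inter> F \<in> generated_complex Fs" "H \<inter> G \<in> generated_complex Gs"
    by (auto simp: generated_complex_def)
  then show "H \<in> simplicial_join (generated_complex Fs) (generated_complex Gs)"
    unfolding simplicial_join_def mem_Collect_eq by metis
qed

lemma generated_complex_Un:
  "generated_complex Fs \<union> generated_complex Gs = generated_complex (Fs \<union> Gs)"
  by (auto simp: generated_complex_def)

section \<open>The complex with 33 facets\<close>

definition Delta_facets :: "vertex set set" where
  "Delta_facets =
    {{V1,X1,X2,X3}, {V1,X1,X2,Y3}, {V1,X1,Y2,X3}, {V1,X1,Y2,Y3},
     {V1,Y1,X2,X3}, {V1,Y1,X2,Y3}, {V1,Y1,Y2,X3}, {V1,Y1,Y2,Y3},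
     {V2,Y1,Y2,Y3}, {V2,Y1,Y2,Z3}, {V2,Y1,Z2,Y3}, {V2,Y1,Z2,Z3},
     {V2,Z1,Y2,Y3}, {V2,Z1,Y2,Z3}, {V2,Z1,Z2,Y3}, {V2,Z1,Z2,Z3},
     {V3,X1,X2,X3}, {V3,X1,X2,Z2}, {V3,X1,Z1,X3}, {V3,X1,Z1,Z2},
     {V3,Z3,X2,X3}, {V3,Z3,X2,Z2}, {V3,Z3,Z1,X3}, {V3,Z3,Z1,Z2},
     {X1,X2,Y3,Z2}, {X2,Y1,Y3,Z2}, {X2,Y1,Z2,Z3},
     {X2,X3,Y1,Z3}, {X3,Y1,Y2,Z3}, {X3,Y2,Z1,Z3},
     {X1,X3,Y2,Z1}, {X1,Y2,Y3,Z1}, {X1,Y3,Z1,Z2}}"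

lemma Delta_eq_generated: "Delta_12_33 = generated_complex Delta_facets"
  unfolding Delta_12_33_def Gamma1_def Gamma2_def cone_over_def octahedron.simps
    simplicial_join_generated generated_complex_Un
  by (rule arg_cong[where f = generated_complex]) code_simp

text \<open>Found by undoing stellar subdivisions: for instance, the link of \<open>V1\<close> is an octahedron one of
  whose diagonals is the non-edge \<open>{X3, Y3}\<close>, so \<open>V1\<close> subdivides that edge.\<close>

lemma Delta_facets_eq_stellar:
  "Delta_facets =
     stellar_facets (stellar_facets (stellar_facets (stellar_facets (stellar_facets (stellar_facets
       (stellar_facets ((\<lambda>v. {X1, Y1, Y2, Z1, V2} - {v}) ` {X1, Y1, Y2, Z1, V2})
         {X1, V2} Y3) {X1, Y1, Y2} X3) {Y1, Y3, Z1} Z2) {Y1, Z1} Z3) {X3, Y3} V1) {X1, Y1} X2)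
         {X1, Z3} V3"
  by code_simp

lemma flag_complex_Delta: "flag_complex (generated_complex Delta_facets)"
proof (rule flag_complex_generatedI)
  \<comment> \<open>A finite check over 33 facets and 12 vertices; membership in the complex is
    restated as inclusion in a facet to make it executable.\<close>
  have "\<forall>F\<in>Delta_facets. \<forall>v\<in>\<Union>Delta_facets. \<exists>H\<in>Delta_facets.
      insert v {u \<in> F. \<exists>G\<in>Delta_facets. u \<in> G \<and> v \<in> G} \<subseteq> H"
    by code_simp
  then show "insert v {u \<in> F. \<exists>G\<in>Delta_facets. u \<in> G \<and> v \<in> G} \<in> generated_complex Delta_facets"
    if "F \<in> Delta_facets" "v \<in> \<Union>Delta_facets" for F v
    using that by (auto simp: generated_complex_def)
qed (auto simp: Delta_facets_def)

lemma simplicial_sphere_Delta: "simplicial_sphere 3 (generated_complex Delta_facets)"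
proof -
  have "UNIV = {X1, X2, X3, Y1, Y2, Y3, Z1, Z2, Z3, V1, V2, V3}"
    using vertex.exhaust by blast
  then have "finite (UNIV :: vertex set)"
    by (metis finite.emptyI finite.insertI)
  then have fin: "finite A" "finite Fs" "\<forall>F\<in>Fs. finite F" for A :: "vertex set" and Fs :: "vertex set set"
    by (simp_all add: finite_subset[OF subset_UNIV] Finite_Set.finite_set)
  show ?thesis
    unfolding Delta_facets_eq_stellar
    \<comment> \<open>Finiteness of \<open>vertex\<close> settles the finiteness conditions;
      evaluation decides that each subdivided face is nonempty, that each new vertex is fresh, and
      that the starting simplex has \<open>3 + 2\<close> vertices.\<close>
    by (intro simplicial_sphere_stellar_facets simplicial_sphere_simplex_boundary fin; code_simp)
qed

theorem theorem3p5:
  shows "flag_complex Delta_12_33 \<and> simplicial_sphere 3 Delta_12_33"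
  unfolding Delta_eq_generated using flag_complex_Delta simplicial_sphere_Delta by blast

end
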